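(* For every real $\alpha\in(0,1)$, $$\liminf_{n\to\infty}\ \gamma(n,\lfloor\alpha n\rceil)\,n^{3/2}\ \le\ \frac{2\pi^2\sqrt{\alpha}}{\sqrt5},$$ and this bound is tight (i.e. equality holds) for a dense set of $\alpha$'s in $(0,1)$.
   Context: $\lfloor x\rceil$ denotes the integer closest to the real number $x$, and $\|x\|=\mathrm{dist}(x,\mathbb{Z})$ the distance from $x$ to the nearest integer. For integers $1\le k<n$ and $m\ne 0$, $$\gamma(n,k,m)=\frac{\pi^2}{2n^2}\left(\frac{m^2k}{n}+4n\left\|\frac{m(n-k)}{2n}\right\|^2\right),\qquad \gamma(n,k)=\min_{m\in\mathbb{Z},\,m\ne0}\gamma(n,k,m).$$ (For $\alpha\in(0,1)$ and all large $n$ one has $1\le\lfloor\alpha n\rceil<n$.) *)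

theory Defs
  imports "HOL-Analysis.Analysis"
begin

definition gamma3 :: "nat \<Rightarrow> int \<Rightarrow> int \<Rightarrow> real" where
  "gamma3 n k m =
     pi\<^sup>2 / (2 * (real n)\<^sup>2) *
       ((real_of_int m)\<^sup>2 * real_of_int k / real n +
        4 * real n * (infdist (real_of_int m * (real n - real_of_int k) / (2 * real n)) \<int>)\<^sup>2)"

(* For 1 \<le> k < n the infimum is attained (lemma gamma2_attained), hence a minimum. *)
definition gamma2 :: "nat \<Rightarrow> int \<Rightarrow> real" where
  "gamma2 n k = (INF m\<in>{m::int. m \<noteq> 0}. gamma3 n k m)"

lemma gamma2_attained:
  fixes n :: nat and k :: int
  assumes "1 \<le> k" "k < int n"
  shows "\<exists>m. m \<noteq> 0 \<and> gamma2 n k = gamma3 n k m \<and> (\<forall>m'. m' \<noteq> 0 \<longrightarrow> gamma3 n k m \<le> gamma3 n k m')"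
proof -
  have n: "real n > 0" using assms by linarith
  have k: "real_of_int k \<ge> 1" using assms by linarith
  define c where "c = pi\<^sup>2 / (2 * (real n)\<^sup>2) * (real_of_int k / real n)"
  have c: "c > 0" using n k unfolding c_def by (intro mult_pos_pos divide_pos_pos) auto
  have low: "c * (real_of_int m)\<^sup>2 \<le> gamma3 n k m" for m
  proof -
    have "c * (real_of_int m)\<^sup>2 =
        pi\<^sup>2 / (2 * (real n)\<^sup>2) * ((real_of_int m)\<^sup>2 * real_of_int k / real n)"
      by (simp add: c_def)
    also have "\<dots> \<le> gamma3 n k m"
      unfolding gamma3_def using n by (intro mult_left_mono) auto
    finally show ?thesis .
  qed
  define B where "B = \<lceil>gamma3 n k 1 / c\<rceil>"
  define F where "F = insert 1 ({-B..B} - {0})"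
  have "finite F" "F \<noteq> {}" by (auto simp: F_def)
  then obtain m where m: "m \<in> F" "\<And>m'. m' \<in> F \<Longrightarrow> gamma3 n k m \<le> gamma3 n k m'"
    using arg_min_if_finite[of F "gamma3 n k"] by (meson not_le)
  have min: "gamma3 n k m \<le> gamma3 n k m'" if "m' \<noteq> 0" for m'
  proof (cases "m' \<in> F")
    case False
    then have "\<bar>m'\<bar> > B" using that by (auto simp: F_def)
    then have "gamma3 n k 1 / c < real_of_int \<bar>m'\<bar>"
      unfolding B_def by linarith
    also have "\<dots> \<le> (real_of_int m')\<^sup>2"
    proof -
      have "real_of_int \<bar>m'\<bar> * 1 \<le> real_of_int \<bar>m'\<bar> * real_of_int \<bar>m'\<bar>"
        using that by (intro mult_left_mono) auto
      then show ?thesis by (simp add: power2_eq_square flip: abs_mult)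
    qed
    finally have "gamma3 n k 1 < c * (real_of_int m')\<^sup>2"
      using c by (simp add: field_simps)
    then show ?thesis using low[of m'] m(2)[of 1] by (auto simp: F_def)
  qed (use m in auto)
  have m0: "m \<noteq> 0" using m(1) by (auto simp: F_def)
  have "gamma2 n k = gamma3 n k m"
    unfolding gamma2_def using m0 min by (intro cInf_eq_minimum) auto
  then show ?thesis using m0 min by blast
qed

(* round sends half-integers upwards. *)
definition liminf_gamma :: "real \<Rightarrow> ereal" where
  "liminf_gamma \<alpha> =
     liminf (\<lambda>n. ereal (gamma2 n (round (\<alpha> * real n)) * real n powr (3/2)))"

end

(* With \<beta> = (1 - \<alpha>) / 2 and k the integer nearest to \<alpha> n, the quantity n^(3/2) \<gamma>(n, k, m) is, up to
   lower order terms, (\<pi>^2 / 2) (m^2 \<alpha> / \<surd>n + 4 \<surd>n \<parallel>m \<beta>\<parallel>^2). By AM-GM this is at least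
   2 \<pi>^2 \<surd>\<alpha> \<cdot> m \<parallel>m \<beta>\<parallel>, with equality at \<surd>n = m \<surd>\<alpha> / (2 \<parallel>m \<beta>\<parallel>), so the liminf measures how
   well \<beta> is approximable by rationals. Hurwitz's theorem gives m \<parallel>m \<beta>\<parallel> \<le> 1 / \<surd>5 for good
   approximations, hence the upper bound. It is sharp when \<beta> is a root of an integer quadratic of
   discriminant 5: the associated binary form takes nonzero integer values, which forces
   m \<parallel>m \<beta>\<parallel> \<ge> 1 / \<surd>5 - o(1). The numbers (p + r \<phi>) / (q + s \<phi>) with q r - p s = 1 and \<phi> the
   golden ratio are such roots, and they are dense. *)

theory Submission
  imports Defs "HOL-Real_Asymp.Real_Asymp"
begin

section \<open>Farey neighbours and Hurwitz's theorem\<close>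

text \<open>Stern-Brocot descent: the mediant replaces one endpoint, which increases the sum of the
  denominators. The interval is half-open so that rational numbers need no separate treatment.\<close>
lemma farey_interval:
  fixes \<beta> :: real
  obtains p q r s :: int where "q > 0" "s > 0" "q * r - p * s = 1"
    "p \<le> \<beta> * q" "\<beta> * s < r" "int n < q * s"
proof -
  have "\<exists>p q r s :: int. q > 0 \<and> s > 0 \<and> q * r - p * s = 1 \<and>
      p \<le> \<beta> * q \<and> \<beta> * s < r \<and> int n < q + s - 1"
  proof (induction n)
    case 0
    show ?case
      by (rule exI[of _ "\<lfloor>\<beta>\<rfloor>"], rule exI[of _ 1], rule exI[of _ "\<lfloor>\<beta>\<rfloor> + 1"], rule exI[of _ 1])
        (use floor_correct[of \<beta>] in simp)
  next
    case (Suc n)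
    then obtain p q r s :: int where *: "q > 0" "s > 0" "q * r - p * s = 1"
      "p \<le> \<beta> * q" "\<beta> * s < r" "int n < q + s - 1" by blast
    show ?case
    proof (cases "\<beta> * (q + s) < p + r")
      case True
      then show ?thesis using *
        by (intro exI[of _ p] exI[of _ q] exI[of _ "p + r"] exI[of _ "q + s"])
          (auto simp: algebra_simps)
    next
      case False
      then show ?thesis using *
        by (intro exI[of _ "p + r"] exI[of _ "q + s"] exI[of _ r] exI[of _ s])
          (auto simp: algebra_simps)
    qed
  qed
  then obtain p q r s :: int where *: "q > 0" "s > 0" "q * r - p * s = 1"
    "p \<le> \<beta> * q" "\<beta> * s < r" "int n < q + s - 1" by blast
  \<comment> \<open>This inequality explains the \<open>- 1\<close> in the induction claim: it turns
    a bound on the sum of the denominators into one on their product.\<close>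
  have "0 \<le> (q - 1) * (s - 1)" using * by simp
  then have "q + s - 1 \<le> q * s" by (simp add: algebra_simps)
  then show thesis using * by (intro that[of q s r p]) auto
qed

text \<open>Farey neighbours are \<open>1 / (q * s)\<close> apart, and a number between them splits
  this gap into \<open>X / q\<close> and \<open>Y / s\<close>. If both ends miss Hurwitz's bound,
  the pieces exceed \<open>1 / (sqrt 5 * q^2)\<close> and \<open>1 / (sqrt 5 * s^2)\<close>, so the
  gap exceeds their sum.\<close>

lemma farey_gap_large:
  fixes q s X Y :: real
  assumes "q > 0" "s > 0" "s * X + q * Y = 1"
    and X: "q * X * sqrt 5 > 1" and Y: "s * Y * sqrt 5 > 1"
  shows "q\<^sup>2 + s\<^sup>2 < sqrt 5 * (q * s)"
proof -
  have "s\<^sup>2 * 1 < s\<^sup>2 * (q * X * sqrt 5)" "q\<^sup>2 * 1 < q\<^sup>2 * (s * Y * sqrt 5)"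
    using assms by (auto intro!: mult_strict_left_mono)
  then have "q\<^sup>2 + s\<^sup>2 < sqrt 5 * (q * s) * (s * X + q * Y)"
    by (simp add: algebra_simps power2_eq_square)
  then show ?thesis using assms by simp
qed

text \<open>With t = s / q, the hypotheses make x^2 - sqrt 5 x + 1 negative at both x = t and x = t
  + 1. Its roots (sqrt 5 - 1) / 2 and (sqrt 5 + 1) / 2 differ by exactly 1, so no such t
  exists.\<close>

lemma farey_gaps_not_both_large:
  fixes q s :: real
  assumes "q\<^sup>2 + s\<^sup>2 < sqrt 5 * (q * s)" "q\<^sup>2 + (q + s)\<^sup>2 < sqrt 5 * (q * (q + s))"
  shows False
proof -
  \<comment> \<open>This square is twice the sum of left minus right sides of the two
    hypotheses.\<close>
  have "0 \<le> ((sqrt 5 - 1) * q - 2 * s)\<^sup>2" by simp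
  also have "\<dots> = (6 - 2 * sqrt 5) * q\<^sup>2 + 4 * s\<^sup>2 - 4 * (sqrt 5 - 1) * (q * s)"
  proof -
    have "(sqrt 5 - 1)\<^sup>2 = 6 - 2 * sqrt 5" by (simp add: power2_diff)
    then show ?thesis by (simp add: power2_diff power_mult_distrib)
  qed
  finally show False using assms by (simp add: algebra_simps power2_eq_square)
qed

text \<open>For a number between neighbours \<open>p / q\<close> and \<open>r / s\<close>, \<open>X\<close> and \<open>Y\<close> are its distances to them scaled by
  the denominators; the last alternative concerns their mediant.\<close>
lemma farey_hurwitz:
  fixes q s X Y :: real
  assumes "q > 0" "s > 0" "X \<ge> 0" "Y \<ge> 0" and det: "s * X + q * Y = 1"
  shows "q * X * sqrt 5 \<le> 1 \<or> s * Y * sqrt 5 \<le> 1 \<or> (q + s) * \<bar>X - Y\<bar> * sqrt 5 \<le> 1"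
proof (rule ccontr)
  assume "\<not> ?thesis"
  then have X: "q * X * sqrt 5 > 1" and Y: "s * Y * sqrt 5 > 1"
    and M: "(q + s) * \<bar>X - Y\<bar> * sqrt 5 > 1" by auto
  have qs: "q\<^sup>2 + s\<^sup>2 < sqrt 5 * (q * s)" using assms X Y by (intro farey_gap_large)
  show False
  \<comment> \<open>The sign of \<open>X - Y\<close> tells on which side of the mediant the number
    lies. The mediant and the end on that side are again neighbours, so the gap estimate applies a
    second time.\<close>
  proof (cases "X \<le> Y")
    case True
    have "q\<^sup>2 + (q + s)\<^sup>2 < sqrt 5 * (q * (q + s))"
      by (rule farey_gap_large[of _ _ X "Y - X"])
        (use True assms X M in \<open>auto simp: algebra_simps\<close>)
    then show ?thesis using qs farey_gaps_not_both_large by blast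
  next
    case False
    have "s\<^sup>2 + (s + q)\<^sup>2 < sqrt 5 * (s * (s + q))"
      by (rule farey_gap_large[of _ _ Y "X - Y"])
        (use False assms Y M in \<open>auto simp: algebra_simps\<close>)
    then show ?thesis using qs farey_gaps_not_both_large[of s q] by (simp add: algebra_simps)
  qed
qed

text \<open>The Farey interval is taken shorter than \<epsilon>, so both ends and the mediant are
  within \<epsilon> of \<beta>. This closeness stands in for infinitely many solutions and covers
  rational \<beta>, where \<open>l / m\<close> may equal \<beta>.\<close>

lemma hurwitz_approximation:
  fixes \<beta> \<epsilon> :: real
  assumes "\<epsilon> > 0"
  obtains m l :: int where "m > 0" "m * \<bar>m * \<beta> - l\<bar> * sqrt 5 \<le> 1" "\<bar>m * \<beta> - l\<bar> < \<epsilon> * m"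
proof -
  obtain n :: nat where n: "1 / \<epsilon> < n" using reals_Archimedean2 by blast
  obtain p q r s :: int where *: "q > 0" "s > 0" "q * r - p * s = 1"
    "p \<le> \<beta> * q" "\<beta> * s < r" "int n < q * s" by (rule farey_interval)
  have "real n < q * s" using *(6) by (metis of_int_less_iff of_int_of_nat_eq of_int_mult)
  with n have "1 / \<epsilon> < q * s" by linarith
  then have qs: "1 < \<epsilon> * (q * s)" using assms by (simp add: field_simps)
  define X Y where "X = \<beta> * q - p" and "Y = r - \<beta> * s"
  have XY: "X \<ge> 0" "Y \<ge> 0" using * by (auto simp: X_def Y_def)
  have "real_of_int (q * r - p * s) = 1" using * by simp
  then have det: "s * X + q * Y = 1" by (simp add: X_def Y_def algebra_simps)
  have pos: "real_of_int q > 0" "real_of_int s > 0" using * by auto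
  have "s * X \<le> 1" "q * Y \<le> 1"
    using det XY pos by (smt (verit) mult_nonneg_nonneg)+
  then have "s * X < s * (\<epsilon> * q)" "q * Y < q * (\<epsilon> * s)" using qs by (auto simp: mult_ac)
  then have small: "X < \<epsilon> * q" "Y < \<epsilon> * s" using pos by simp_all
  consider "q * X * sqrt 5 \<le> 1" | "s * Y * sqrt 5 \<le> 1" | "(real_of_int q + s) * \<bar>X - Y\<bar> * sqrt 5 \<le> 1"
    using farey_hurwitz[OF pos XY det] by blast
  then show thesis
  proof cases
    case 1
    then show ?thesis using * small XY
      by (intro that[of q p]) (auto simp: X_def mult_ac)
  next
    case 2
    then show ?thesis using * small XY
      by (intro that[of s r]) (auto simp: Y_def mult_ac abs_if)
  next
    case 3
    have e: "\<beta> * (q + s) - (p + r) = X - Y" by (simp add: X_def Y_def algebra_simps)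
    have "\<bar>X - Y\<bar> < \<epsilon> * q + \<epsilon> * s" using small XY by linarith
    then show ?thesis using 3 * e
      by (intro that[of "q + s" "p + r"]) (simp_all add: mult.commute distrib_left)
  qed
qed

section \<open>Quadratic numbers of discriminant 5\<close>

text \<open>Irrationality of sqrt 5: for nonzero \<open>m\<close> the 5-adic valuation would be even
  on the left and odd on the right.\<close>

lemma square_eq_5_mult_square:
  fixes x m :: int
  assumes "x\<^sup>2 = 5 * m\<^sup>2"
  shows "m = 0"
proof (rule ccontr)
  assume m: "m \<noteq> 0"
  then have "x \<noteq> 0" using assms by auto
  have 5: "prime_elem (5 :: int)" by simp
  have "2 * multiplicity 5 x = multiplicity 5 (x\<^sup>2)"
    using \<open>x \<noteq> 0\<close> by (simp add: prime_elem_multiplicity_power_distrib[OF 5])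
  also have "\<dots> = 1 + 2 * multiplicity 5 m"
    using m by (simp add: assms prime_elem_multiplicity_mult_distrib[OF 5]
        prime_elem_multiplicity_power_distrib[OF 5])
  finally show False by presburger
qed

text \<open>The leading coefficient is a parameter because it controls the error term in the
  approximation bound; \<open>b\<close> and \<open>c\<close> leave no trace there.\<close>

definition disc5_root :: "int \<Rightarrow> real \<Rightarrow> bool" where
  "disc5_root a \<beta> \<longleftrightarrow> (\<exists>b c :: int. b\<^sup>2 - 4 * a * c = 5 \<and>
    real_of_int a * \<beta>\<^sup>2 + real_of_int b * \<beta> + real_of_int c = 0)"

text \<open>The binary form \<open>f\<close> at \<open>(l, m)\<close> is a nonzero integer, so its
  absolute value is at least 1. Expanded around \<open>l = m * \<beta>\<close> it has no constant
  term, and its linear coefficient is \<open>m\<close> times the derivative \<open>S\<close> of the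
  quadratic at \<beta>, which is a square root of the discriminant up to sign.\<close>

lemma disc5_root_badly_approximable:
  fixes a l m :: int and \<beta> :: real
  assumes "disc5_root a \<beta>" "m \<noteq> 0"
  shows "1 \<le> sqrt 5 * (\<bar>m\<bar> * \<bar>m * \<beta> - l\<bar>) + \<bar>a\<bar> * (m * \<beta> - l)\<^sup>2"
proof -
  obtain b c :: int where disc: "b\<^sup>2 - 4 * a * c = 5" and root: "a * \<beta>\<^sup>2 + b * \<beta> + c = 0"
    using assms unfolding disc5_root_def by blast
  define f where "f = a * l\<^sup>2 + b * l * m + c * m\<^sup>2"
  have f: "f \<noteq> 0"
  proof
    assume "f = 0"
    \<comment> \<open>Completing the square: a zero of \<open>f\<close> would make
      \<open>5 * m^2\<close> a perfect square.\<close>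
    have "(2 * a * l + b * m)\<^sup>2 = (b\<^sup>2 - 4 * a * c) * m\<^sup>2 + 4 * a * f"
      unfolding f_def by algebra
    with \<open>f = 0\<close> disc have "(2 * a * l + b * m)\<^sup>2 = 5 * m\<^sup>2" by simp
    then show False using square_eq_5_mult_square assms by blast
  qed
  define S where "S = 2 * a * \<beta> + b"
  have "real_of_int (b\<^sup>2 - 4 * a * c) = 5" using disc by simp
  moreover have "S\<^sup>2 = 4 * a * (a * \<beta>\<^sup>2 + b * \<beta> + c) + real_of_int (b\<^sup>2 - 4 * a * c)"
    by (simp add: S_def algebra_simps power2_eq_square)
  ultimately have "S\<^sup>2 = 5" using root by simp
  then have S: "\<bar>S\<bar> = sqrt 5" by (metis real_sqrt_abs)
  define D where "D = m * \<beta> - l"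
  have "real_of_int f = m\<^sup>2 * (a * \<beta>\<^sup>2 + b * \<beta> + c) + a * D\<^sup>2 - S * m * D"
    by (simp add: f_def S_def D_def algebra_simps power2_eq_square)
  then have "real_of_int f = a * D\<^sup>2 - S * m * D" using root by simp
  moreover have "1 \<le> \<bar>real_of_int f\<bar>" using f by linarith
  ultimately have "1 \<le> \<bar>a * D\<^sup>2\<bar> + \<bar>S * m * D\<bar>" by linarith
  then show ?thesis by (simp add: abs_mult S mult_ac D_def)
qed

text \<open>A Moebius map of determinant 1 sends the golden ratio to another root of discriminant 5,
  and sends positive numbers into the interval between \<open>p / q\<close> and
  \<open>r / s\<close>, which can be made short.\<close>

lemma disc5_root_dense:
  fixes \<beta> \<epsilon> :: real
  assumes "\<epsilon> > 0"
  obtains a x where "disc5_root a x" "\<bar>x - \<beta>\<bar> < \<epsilon>"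
proof -
  obtain n :: nat where n: "1 / \<epsilon> < n" using reals_Archimedean2 by blast
  obtain p q r s :: int where *: "q > 0" "s > 0" "q * r - p * s = 1"
    "p \<le> \<beta> * q" "\<beta> * s < r" "int n < q * s" by (rule farey_interval)
  have "real n < q * s" using *(6) by (metis of_int_less_iff of_int_of_nat_eq of_int_mult)
  with n have "1 / \<epsilon> < q * s" by linarith
  then have qs: "1 < \<epsilon> * (q * s)" using assms by (simp add: field_simps)
  have pos: "real_of_int q > 0" "real_of_int s > 0" using * by auto
  have "real_of_int (q * r - p * s) = 1" using * by simp
  then have det: "q * r - p * s = (1::real)" by simp
  have gap: "r / s - p / q < \<epsilon>"
  proof -
    have "r / s - p / q = 1 / (q * s)" using pos det by (simp add: field_simps)
    also have "\<dots> < \<epsilon>" using pos qs by (simp add: field_simps)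
    finally show ?thesis .
  qed
  define \<phi> :: real where "\<phi> = (1 + sqrt 5) / 2"
  have \<phi>: "\<phi>\<^sup>2 = \<phi> + 1" "\<phi> > 0"
    by (auto simp: \<phi>_def power2_eq_square field_simps intro: add_pos_pos)
  define x where "x = (p + r * \<phi>) / (q + s * \<phi>)"
  have d: "q + s * \<phi> > 0" using pos \<phi> by (simp add: add_pos_pos)
  have "0 \<le> (q * r - p * s) * \<phi>" using \<phi> by (subst det) simp
  then have low: "p / q \<le> x" using pos d by (simp add: x_def divide_simps) (simp add: algebra_simps)
  have "p * s \<le> (q * r :: real)" using det by linarith
  then have high: "x \<le> r / s" using pos d by (simp add: x_def divide_simps) (simp add: algebra_simps)
  have "p / q \<le> \<beta>" "\<beta> < r / s" using * pos by (simp_all add: field_simps)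
  with low high gap have near: "\<bar>x - \<beta>\<bar> < \<epsilon>" by linarith
  \<comment> \<open>Coefficients obtained by solving for \<phi> as
    \<open>(p - q * x) / (s * x - r)\<close>, substituting into \<phi>^2 = \<phi> + 1 and clearing
    denominators.\<close>
  define a b c where "a = q\<^sup>2 + q * s - s\<^sup>2" and "b = 2 * r * s - 2 * p * q - p * s - q * r"
    and "c = p\<^sup>2 + p * r - r\<^sup>2"
  have "b\<^sup>2 - 4 * a * c = 5 * (q * r - p * s)\<^sup>2" unfolding a_def b_def c_def by algebra
  then have disc: "b\<^sup>2 - 4 * a * c = 5" using * by simp
  have "x * (q + s * \<phi>) = p + r * \<phi>" using d by (simp add: x_def)
  then have e: "\<phi> * (s * x - r) = p - q * x" by (simp add: algebra_simps)
  have "(p - q * x)\<^sup>2 = (\<phi> + 1) * (s * x - r)\<^sup>2"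
    unfolding e[symmetric] power_mult_distrib \<phi>(1) ..
  also have "\<dots> = (p - q * x) * (s * x - r) + (s * x - r)\<^sup>2"
    unfolding e[symmetric] by (simp add: algebra_simps power2_eq_square)
  finally have "a * x\<^sup>2 + b * x + c = 0"
    unfolding a_def b_def c_def by (simp add: algebra_simps power2_eq_square)
  with disc near show thesis by (intro that[of a x]) (auto simp: disc5_root_def)
qed

section \<open>The normalized quantity and its rounding errors\<close>

text \<open>This is n^(3/2) \<gamma>(n, k, m) at the rounded k, without the constant factor
  \<open>pi^2 / 2\<close>; the value to compare with is then
  \<open>4 * sqrt \<alpha> / sqrt 5\<close>.\<close>

definition normalized_form :: "real \<Rightarrow> nat \<Rightarrow> int \<Rightarrow> real" where
  "normalized_form \<alpha> n m =
     (real_of_int m)\<^sup>2 * (round (\<alpha> * real n) / n) / sqrt n +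
     4 * sqrt n * (infdist (m * (real n - round (\<alpha> * real n)) / (2 * real n)) \<int>)\<^sup>2"

lemma gamma3_normalized_form:
  assumes "n > 0"
  shows "gamma3 n (round (\<alpha> * real n)) m * n powr (3/2) = pi\<^sup>2 / 2 * normalized_form \<alpha> n m"
proof -
  define w where "w = sqrt n"
  have w: "w > 0" "real n = w\<^sup>2" using assms by (auto simp: w_def)
  have "real n powr (3/2) = (real n powr (1/2)) powr 3" by (simp add: powr_powr)
  also have "\<dots> = w ^ 3" using w(1) by (simp add: w_def powr_half_sqrt)
  finally have p: "real n powr (3/2) = w ^ 3" .
  define I where "I = infdist (m * (real n - round (\<alpha> * real n)) / (2 * real n)) \<int>"
  define k where "k = real_of_int (round (\<alpha> * real n))"
  have "gamma3 n (round (\<alpha> * real n)) m * n powr (3/2) =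
      pi\<^sup>2 / (2 * (w\<^sup>2)\<^sup>2) * ((real_of_int m)\<^sup>2 * k / w\<^sup>2 + 4 * w\<^sup>2 * I\<^sup>2) * w ^ 3"
    by (simp only: gamma3_def I_def k_def p flip: w(2))
  also have "\<dots> = pi\<^sup>2 / 2 * ((real_of_int m)\<^sup>2 * (k / w\<^sup>2) / w + 4 * w * I\<^sup>2)"
    using w(1) by (simp add: field_simps power2_eq_square eval_nat_numeral)
  also have "\<dots> = pi\<^sup>2 / 2 * normalized_form \<alpha> n m"
    by (simp only: normalized_form_def I_def k_def w_def[symmetric] flip: w(2))
  finally show ?thesis .
qed

lemma round_mult_divide_near:
  assumes "n > 0"
  shows "\<bar>round (\<alpha> * real n) / n - \<alpha>\<bar> \<le> 1 / (2 * real n)"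
proof -
  have "\<bar>round (\<alpha> * real n) - \<alpha> * n\<bar> \<le> 1 / 2"
    using of_int_round_abs_le[of "\<alpha> * n"] by simp
  moreover have "round (\<alpha> * real n) / n - \<alpha> = (round (\<alpha> * real n) - \<alpha> * n) / n"
    using assms by (simp add: field_simps)
  ultimately show ?thesis using assms by (simp add: field_simps)
qed

lemma scaled_argument_near:
  fixes m :: int and \<alpha> \<beta> :: real
  assumes "n > 0" "\<beta> = (1 - \<alpha>) / 2"
  shows "\<bar>m * (real n - round (\<alpha> * real n)) / (2 * real n) - m * \<beta>\<bar> \<le> \<bar>m\<bar> / (4 * real n)"
proof -
  have "m * (real n - round (\<alpha> * real n)) / (2 * real n) - m * \<beta> = m / 2 * (\<alpha> - round (\<alpha> * real n) / n)"
    unfolding assms(2) using assms(1) by (simp add: field_simps)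
  then have "\<bar>m * (real n - round (\<alpha> * real n)) / (2 * real n) - m * \<beta>\<bar>
      = \<bar>m\<bar> / 2 * \<bar>round (\<alpha> * real n) / n - \<alpha>\<bar>"
    by (simp only: abs_mult abs_divide abs_minus_commute[of \<alpha>] of_int_abs abs_numeral)
  also have "\<dots> \<le> \<bar>m\<bar> / 2 * (1 / (2 * real n))"
    using assms by (intro mult_left_mono round_mult_divide_near) auto
  finally show ?thesis by simp
qed

section \<open>Upper bound by good approximations\<close>

lemma normalized_form_le:
  fixes m l :: int and \<alpha> \<beta> \<delta> w :: real
  assumes n: "n > 0" and m: "m > 0" and \<beta>: "\<beta> = (1 - \<alpha>) / 2"
    and w: "w = sqrt n" and \<delta>: "\<delta> = \<bar>m * \<beta> - l\<bar>"
  shows "normalized_form \<alpha> n m \<le>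
    (real_of_int m)\<^sup>2 * \<alpha> / w + 4 * w * \<delta>\<^sup>2 + 2 * \<delta> * m / w + 3 * (real_of_int m)\<^sup>2 / (4 * w ^ 3)"
proof -
  have w': "w > 0" "real n = w\<^sup>2" using n by (auto simp: w)
  let ?x = "m * (real n - round (\<alpha> * real n)) / (2 * real n)"
  have "infdist ?x \<int> \<le> dist ?x (of_int l)" by (rule infdist_le) simp
  also have "\<dots> \<le> \<delta> + \<bar>m\<bar> / (4 * real n)"
    unfolding dist_real_def \<delta> using scaled_argument_near[OF n \<beta>, of m] by linarith
  finally have "infdist ?x \<int> \<le> \<delta> + m / (4 * w\<^sup>2)" using m w' by simp
  then have "(infdist ?x \<int>)\<^sup>2 \<le> (\<delta> + m / (4 * w\<^sup>2))\<^sup>2"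
    by (intro power_mono) (auto simp: infdist_nonneg)
  then have 1: "4 * w * (infdist ?x \<int>)\<^sup>2 \<le> 4 * w * (\<delta> + m / (4 * w\<^sup>2))\<^sup>2" using w' by simp
  have 2: "(real_of_int m)\<^sup>2 * (round (\<alpha> * real n) / n) / w \<le> (real_of_int m)\<^sup>2 * (\<alpha> + 1 / (2 * w\<^sup>2)) / w"
  proof -
    have "round (\<alpha> * real n) / n \<le> \<alpha> + 1 / (2 * w\<^sup>2)"
      using round_mult_divide_near[OF n, of \<alpha>] unfolding w'(2) by linarith
    then show ?thesis using w' by (intro divide_right_mono mult_left_mono) auto
  qed
  have "normalized_form \<alpha> n m \<le>
      (real_of_int m)\<^sup>2 * (\<alpha> + 1 / (2 * w\<^sup>2)) / w + 4 * w * (\<delta> + m / (4 * w\<^sup>2))\<^sup>2"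
    unfolding normalized_form_def w[symmetric] using 1 2 by linarith
  \<comment> \<open>The last term collects m^2 / (2 w^3) from rounding in the first summand and m^2
    / (4 w^3) from rounding inside the distance.\<close>
  also have "\<dots> = (real_of_int m)\<^sup>2 * \<alpha> / w + 4 * w * \<delta>\<^sup>2 + 2 * \<delta> * m / w + 3 * (real_of_int m)\<^sup>2 / (4 * w ^ 3)"
    using w'(1) by (simp add: field_simps power2_eq_square eval_nat_numeral)
  finally show ?thesis .
qed

lemma normalized_form_small:
  assumes \<alpha>: "0 < \<alpha>" "\<alpha> < 1" and T: "T \<ge> 1"
  shows "\<exists>n m. real n \<ge> T \<and> m > 0 \<and>
    normalized_form \<alpha> n m \<le> 4 * sqrt \<alpha> / sqrt 5 + (2 + 1 / \<alpha>) / T"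
proof -
  define \<beta> where "\<beta> = (1 - \<alpha>) / 2"
  \<comment> \<open>This tolerance is what makes the balancing point \<open>t\<close> below at least
    \<open>T\<close>.\<close>
  obtain m l :: int where ml: "m > 0" "m * \<bar>m * \<beta> - l\<bar> * sqrt 5 \<le> 1"
    "\<bar>m * \<beta> - l\<bar> < sqrt \<alpha> / (2 * T) * m"
    using hurwitz_approximation[of "sqrt \<alpha> / (2 * T)" \<beta>] \<alpha> T by auto
  define \<delta> where "\<delta> = \<bar>m * \<beta> - l\<bar>"
  have m1: "real_of_int m \<ge> 1" using ml by linarith
  have s2: "sqrt 5 \<ge> 2" by (rule real_le_rsqrt) simp
  note bound = normalized_form_le[OF _ ml(1) \<beta>_def _ \<delta>_def]
  show ?thesis
  proof (cases "\<delta> = 0")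
    case True
    \<comment> \<open>Here \<beta> = l / m, so the only main term left is
      \<open>m^2 * \<alpha> / w\<close>, and a large \<open>n\<close> makes it small.\<close>
    define n where "n = nat \<lceil>((real_of_int m)\<^sup>2 * T)\<^sup>2\<rceil>"
    define w where "w = sqrt n"
    have "((real_of_int m)\<^sup>2 * T)\<^sup>2 \<le> n" unfolding n_def by linarith
    then have w1: "(real_of_int m)\<^sup>2 * T \<le> w" unfolding w_def using T by (intro real_le_rsqrt) auto
    have m2: "1 \<le> (real_of_int m)\<^sup>2" using m1 by simp
    have "1 * T \<le> (real_of_int m)\<^sup>2 * T" using m2 T by (intro mult_right_mono) auto
    then have w2: "T \<le> w" using w1 by simp
    then have "w * 1 \<le> w * w" using T by (intro mult_left_mono) auto
    then have nw: "w \<le> n" by (simp add: w_def)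
    have n0: "n > 0" using nw w2 T by linarith
    have a: "(real_of_int m)\<^sup>2 / w \<le> 1 / T" using w1 w2 T by (simp add: field_simps)
    have "(real_of_int m)\<^sup>2 / w * \<alpha> \<le> (real_of_int m)\<^sup>2 / w * 1" using \<alpha> w2 T by (intro mult_left_mono) auto
    then have b: "(real_of_int m)\<^sup>2 * \<alpha> / w \<le> 1 / T" using a by simp
    have "3 * (real_of_int m)\<^sup>2 / (4 * w ^ 3) \<le> (real_of_int m)\<^sup>2 / w"
    proof -
      have "1 \<le> w\<^sup>2" using w2 T by simp
      then have "(real_of_int m)\<^sup>2 * 3 \<le> (real_of_int m)\<^sup>2 * (4 * w\<^sup>2)" by (intro mult_left_mono) auto
      then show ?thesis using w2 T by (simp add: field_simps eval_nat_numeral)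
    qed
    then have "normalized_form \<alpha> n m \<le> 1 / T + 1 / T"
      using bound[OF n0 w_def] True a b by simp
    also have "\<dots> \<le> (2 + 1 / \<alpha>) / T"
      using \<alpha> T by (simp add: field_simps)
    also have "\<dots> \<le> 4 * sqrt \<alpha> / sqrt 5 + (2 + 1 / \<alpha>) / T" using \<alpha> by simp
    finally show ?thesis using ml(1) nw w2 by (intro exI[of _ n] exI[of _ m]) auto
  next
    case False
    then have d: "\<delta> > 0" by (auto simp: \<delta>_def)
    \<comment> \<open>The value of sqrt n at which the two main terms are equal. Rounding
      \<open>t^2\<close> up gives \<open>t \<le> w \<le> t + 1\<close>, which costs only O(1 /
      t).\<close>
    define t where "t = m * sqrt \<alpha> / (2 * \<delta>)"
    have tT: "T \<le> t" using ml(3) d T unfolding t_def \<delta>_def[symmetric] by (simp add: field_simps)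
    then have t1: "1 \<le> t" using T by simp
    define n where "n = nat \<lceil>t\<^sup>2\<rceil>"
    define w where "w = sqrt n"
    have n: "t\<^sup>2 \<le> n" "n < t\<^sup>2 + 1" unfolding n_def by (simp_all) linarith+
    have tw: "t \<le> w" unfolding w_def using n by (intro real_le_rsqrt)
    have wt: "w \<le> t + 1"
      unfolding w_def using n t1 by (intro real_le_lsqrt) (auto simp: power2_eq_square algebra_simps)
    have "t * 1 \<le> t * t" using t1 by (intro mult_left_mono) auto
    then have nt: "t \<le> n" using n by (simp add: power2_eq_square)
    have n0: "n > 0" using nt t1 by linarith
    \<comment> \<open>Common value of the two main terms at \<open>w = t\<close>; Hurwitz's bound on
      \<open>m * \<delta>\<close> gives
      \<open>2 * P \<le> 4 * sqrt \<alpha> / sqrt 5\<close>.\<close>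
    define P where "P = (real_of_int m)\<^sup>2 * \<alpha> / t"
    have sa: "sqrt \<alpha> * sqrt \<alpha> = \<alpha>" "0 < sqrt \<alpha>" "sqrt \<alpha> < 1" using \<alpha> by auto
    have P': "P = (real_of_int m)\<^sup>2 * (sqrt \<alpha> * sqrt \<alpha>) / (m * sqrt \<alpha> / (2 * \<delta>))"
      unfolding P_def t_def sa(1) ..
    have P: "P = 2 * (m * \<delta>) * sqrt \<alpha>"
      unfolding P' using m1 sa(2) d by (simp add: field_simps power2_eq_square)
    have md: "m * \<delta> \<le> 1 / sqrt 5" using ml(2) unfolding \<delta>_def by (simp add: field_simps)
    also have "\<dots> \<le> 1 / 2" using s2 by (simp add: field_simps)
    finally have md2: "2 * (m * \<delta>) \<le> 1" by simp
    have "2 * (m * \<delta>) * sqrt \<alpha> \<le> 1 * 1" using md2 sa by (intro mult_mono) auto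
    then have P1: "P \<le> 1" using P by simp
    have "m * \<delta> * sqrt \<alpha> \<le> 1 / sqrt 5 * sqrt \<alpha>" using md sa by (intro mult_right_mono) auto
    then have P2: "2 * P \<le> 4 * sqrt \<alpha> / sqrt 5" using P by simp
    have Pd: "4 * \<delta>\<^sup>2 = P / t"
      unfolding P' t_def using m1 sa(2) d by (simp add: field_simps power2_eq_square)
    have a: "(real_of_int m)\<^sup>2 * \<alpha> / w \<le> P"
      unfolding P_def using tw t1 \<alpha> by (intro divide_left_mono) auto
    have "4 * w * \<delta>\<^sup>2 = w * (P / t)" by (simp flip: Pd)
    also have "\<dots> \<le> (t + 1) * (P / t)" using wt t1 \<alpha> by (intro mult_right_mono) (auto simp: P_def)
    also have "\<dots> = P + P / t" using t1 by (simp add: field_simps)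
    also have "P / t \<le> 1 / t" using P1 t1 by (simp add: divide_right_mono)
    finally have b: "4 * w * \<delta>\<^sup>2 \<le> P + 1 / t" by simp
    have "2 * \<delta> * m / w \<le> 1 / w" using md2 tw t1 by (intro divide_right_mono) (auto simp: mult_ac)
    also have "\<dots> \<le> 1 / t" using tw t1 by (intro divide_left_mono) auto
    finally have c: "2 * \<delta> * m / w \<le> 1 / t" .
    have "(real_of_int m)\<^sup>2 = P * t / \<alpha>" using t1 \<alpha> by (simp add: P_def)
    also have "\<dots> \<le> 1 * t / \<alpha>" using P1 t1 \<alpha> by (intro divide_right_mono mult_right_mono) auto
    finally have m2: "(real_of_int m)\<^sup>2 \<le> t / \<alpha>" by simp
    have t3: "t\<^sup>2 \<le> w ^ 3" 
    proof -
      have "t\<^sup>2 * 1 \<le> w\<^sup>2 * w" using tw t1 by (intro mult_mono power_mono) auto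
      then show ?thesis by (simp add: eval_nat_numeral)
    qed
    have "3 * (real_of_int m)\<^sup>2 / (4 * w ^ 3) \<le> (real_of_int m)\<^sup>2 / w ^ 3" using tw t1 by (simp add: field_simps)
    also have "\<dots> \<le> (t / \<alpha>) / t\<^sup>2"
      using m2 t3 t1 tw \<alpha> by (intro frac_le) auto
    also have "\<dots> = (1 / \<alpha>) / t" using t1 by (simp add: power2_eq_square)
    finally have e: "3 * (real_of_int m)\<^sup>2 / (4 * w ^ 3) \<le> (1 / \<alpha>) / t" .
    have "normalized_form \<alpha> n m \<le> 2 * P + (2 + 1 / \<alpha>) / t"
      using bound[OF n0 w_def] a b c e by (simp add: add_divide_distrib)
    also have "(2 + 1 / \<alpha>) / t \<le> (2 + 1 / \<alpha>) / T"
      using \<alpha> tT T by (intro divide_left_mono) auto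
    finally show ?thesis using P2 ml(1) nt tT by (intro exI[of _ n] exI[of _ m]) auto
  qed
qed

lemma normalized_form_nonneg:
  assumes "\<alpha> \<ge> 0" shows "normalized_form \<alpha> n m \<ge> 0"
proof -
  have "round (\<alpha> * real n) \<ge> 0" using round_mono[of 0 "\<alpha> * n"] assms by simp
  then show ?thesis unfolding normalized_form_def by simp
qed

lemma gamma2_normalized:
  assumes "n > 0" "\<alpha> \<ge> 0"
  shows "m \<noteq> 0 \<Longrightarrow> gamma2 n (round (\<alpha> * real n)) * n powr (3/2) \<le> pi\<^sup>2 / 2 * normalized_form \<alpha> n m"
    and "(\<And>m. m \<noteq> 0 \<Longrightarrow> c \<le> normalized_form \<alpha> n m) \<Longrightarrow>
      pi\<^sup>2 / 2 * c \<le> gamma2 n (round (\<alpha> * real n)) * n powr (3/2)"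
proof -
  define N where "N = real n powr (3/2)"
  have N: "N > 0" using assms by (simp add: N_def)
  have eq: "gamma3 n (round (\<alpha> * real n)) m = pi\<^sup>2 / 2 * normalized_form \<alpha> n m / N" for m
    using gamma3_normalized_form[of n \<alpha> m] assms N by (simp add: field_simps N_def)
  {
    assume m: "m \<noteq> 0"
    have "gamma2 n (round (\<alpha> * real n)) \<le> gamma3 n (round (\<alpha> * real n)) m"
      unfolding gamma2_def
    proof (rule cINF_lower)
      show "bdd_below (gamma3 n (round (\<alpha> * real n)) ` {m. m \<noteq> 0})"
        using N normalized_form_nonneg[OF assms(2)] by (intro bdd_belowI[of _ 0]) (auto simp: eq)
    qed (use m in auto)
    then show "gamma2 n (round (\<alpha> * real n)) * n powr (3/2) \<le> pi\<^sup>2 / 2 * normalized_form \<alpha> n m"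
      using N unfolding eq N_def[symmetric] by (simp add: field_simps)
  }
  {
    assume c: "\<And>m. m \<noteq> 0 \<Longrightarrow> c \<le> normalized_form \<alpha> n m"
    have "pi\<^sup>2 / 2 * c / N \<le> gamma2 n (round (\<alpha> * real n))"
      unfolding gamma2_def
    proof (rule cINF_greatest)
      show "{m::int. m \<noteq> 0} \<noteq> {}" by (auto intro: exI[of _ 1])
    next
      fix m :: int assume "m \<in> {m. m \<noteq> 0}"
      then show "pi\<^sup>2 / 2 * c / N \<le> gamma3 n (round (\<alpha> * real n)) m"
        unfolding eq using c[of m] N by (intro divide_right_mono mult_left_mono) auto
    qed
    then show "pi\<^sup>2 / 2 * c \<le> gamma2 n (round (\<alpha> * real n)) * n powr (3/2)"
      using N unfolding N_def[symmetric] by (simp add: field_simps)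
  }
qed

lemma liminf_gamma_le:
  assumes \<alpha>: "0 < \<alpha>" "\<alpha> < 1"
  shows "liminf_gamma \<alpha> \<le> ereal (2 * pi\<^sup>2 * sqrt \<alpha> / sqrt 5)"
proof (rule ccontr)
  define L where "L = 2 * pi\<^sup>2 * sqrt \<alpha> / sqrt 5"
  define g where "g n = gamma2 n (round (\<alpha> * real n)) * real n powr (3/2)" for n
  assume "\<not> ?thesis"
  then have "ereal L < liminf_gamma \<alpha>" by (simp add: L_def)
  then obtain c where c: "ereal L < ereal c" "ereal c < liminf_gamma \<alpha>"
    using ereal_dense2 by blast
  then have "\<forall>\<^sub>F n in sequentially. ereal c < ereal (g n)"
    unfolding liminf_gamma_def g_def by (intro less_LiminfD)
  then obtain N where N: "\<And>n. n \<ge> N \<Longrightarrow> c < g n" by (auto simp: eventually_sequentially)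
  have Lc: "c - L > 0" using c by simp
  define K where "K = pi\<^sup>2 / 2 * (2 + 1 / \<alpha>)"
  have K: "K > 0" using \<alpha> by (auto simp: K_def intro!: mult_pos_pos add_pos_pos)
  \<comment> \<open>The bound \<open>N\<close> puts \<open>n\<close> in the range where
    \<open>g n > c\<close>; the bound \<open>K / (c - L)\<close> makes the error fit into the gap
    between \<open>L\<close> and \<open>c\<close>.\<close>
  define T where "T = max (real N) (max 1 (K / (c - L)))"
  have T: "T \<ge> 1" "T \<ge> N" "T \<ge> K / (c - L)" by (auto simp: T_def)
  obtain n m where n: "real n \<ge> T" "m > 0"
    "normalized_form \<alpha> n m \<le> 4 * sqrt \<alpha> / sqrt 5 + (2 + 1 / \<alpha>) / T"
    using normalized_form_small[OF \<alpha> T(1)] by blast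
  have "n > 0" "n \<ge> N" using n(1) T by linarith+
  then have "g n \<le> pi\<^sup>2 / 2 * normalized_form \<alpha> n m"
    unfolding g_def using \<alpha> n by (intro gamma2_normalized) auto
  also have "\<dots> \<le> pi\<^sup>2 / 2 * (4 * sqrt \<alpha> / sqrt 5 + (2 + 1 / \<alpha>) / T)"
    using n by (intro mult_left_mono) auto
  also have "\<dots> = L + K / T" by (simp add: L_def K_def distrib_left)
  also have "K / T \<le> c - L" using T Lc by (simp add: field_simps)
  finally show False using N[OF \<open>n \<ge> N\<close>] by simp
qed

section \<open>Lower bound at roots of discriminant 5\<close>

text \<open>The minimum leaves only those \<open>m\<close> whose value is below the target. For them
  m^2 is O(sqrt n) and the squared distance is O(1 / sqrt n), so rounding and the quadratic term of
  the approximation bound are negligible, and AM-GM concludes. \<open>C\<close> depends on neither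
  \<open>m\<close> nor \<open>n\<close>.\<close>

lemma normalized_form_ge:
  fixes a m :: int and \<alpha> \<beta> C :: real
  assumes \<alpha>: "0 < \<alpha>" "\<alpha> < 1" and root: "disc5_root a \<beta>" and \<beta>: "\<beta> = (1 - \<alpha>) / 2"
    and n: "real n \<ge> 1 / \<alpha>" and m: "m \<noteq> 0"
    and C: "C = \<bar>a\<bar> * (1 + 1 / \<alpha>) + 1 / \<alpha>"
  shows "min (4 * sqrt \<alpha> / sqrt 5) (4 * sqrt (round (\<alpha> * real n) / n) * (1 / sqrt 5 - C / sqrt n))
    \<le> normalized_form \<alpha> n m"
proof (cases "normalized_form \<alpha> n m < 4 * sqrt \<alpha> / sqrt 5")
  case True
  have s2: "sqrt 5 \<ge> 2" by (rule real_le_rsqrt) simp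
  have n1: "real n > 1" using n \<alpha> by (smt (verit) less_divide_eq_1_pos)
  then have n0: "n > 0" by simp
  define w where "w = sqrt n"
  have w: "w \<ge> 1" "real n = w\<^sup>2" using n1 by (auto simp: w_def)
  define Q where "Q = round (\<alpha> * real n) / n"
  have "1 / (2 * real n) \<le> \<alpha> / 2" using n n0 \<alpha> by (simp add: field_simps)
  then have Q: "\<alpha> / 2 \<le> Q" using round_mult_divide_near[OF n0, of \<alpha>] unfolding Q_def by linarith
  let ?x = "m * (real n - round (\<alpha> * real n)) / (2 * real n)"
  define \<eta> where "\<eta> = infdist ?x \<int>"
  have e0: "\<eta> \<ge> 0" by (simp add: \<eta>_def infdist_nonneg)
  \<comment> \<open>The approximation bound needs an actual integer \<open>l\<close>, hence a
    nearest one.\<close>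
  obtain z :: real where z: "z \<in> \<int>" "\<eta> = dist ?x z"
    using infdist_attains_inf[OF closed_Ints] unfolding \<eta>_def by (metis Ints_0 empty_iff)
  then obtain l :: int where l: "z = l" by (auto elim: Ints_cases)
  define \<delta> where "\<delta> = \<bar>m * \<beta> - l\<bar>"
  define M where "M = real_of_int \<bar>m\<bar>"
  have M: "M \<ge> 1" "(real_of_int m)\<^sup>2 = M\<^sup>2" using m by (auto simp: M_def)
  have de: "\<delta> \<le> \<eta> + M / (4 * w\<^sup>2)"
    unfolding \<delta>_def z l dist_real_def M_def w(2)[symmetric]
    using scaled_argument_near[OF n0 \<beta>, of m] by linarith
  have form: "normalized_form \<alpha> n m = M\<^sup>2 * Q / w + 4 * w * \<eta>\<^sup>2"
    by (simp add: normalized_form_def Q_def \<eta>_def w_def M)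
  have "sqrt \<alpha> < 1" using \<alpha> by simp
  then have "2 * sqrt \<alpha> \<le> sqrt 5" using s2 by linarith
  then have "4 * sqrt \<alpha> / sqrt 5 \<le> 2" by (simp add: divide_simps)
  then have small: "M\<^sup>2 * Q / w + 4 * w * \<eta>\<^sup>2 < 2" using True form by linarith
  have nn: "0 \<le> M\<^sup>2 * Q / w" "0 \<le> 4 * w * \<eta>\<^sup>2" using Q \<alpha> w by auto
  have "M\<^sup>2 * (\<alpha> / 2) / w \<le> M\<^sup>2 * Q / w"
    using Q w by (intro divide_right_mono mult_left_mono) auto
  then have "M\<^sup>2 * (\<alpha> / 2) / w \<le> 2" using small nn by linarith
  then have M2: "M\<^sup>2 \<le> 4 * w / \<alpha>" using w \<alpha> by (simp add: field_simps)
  have "4 * w * \<eta>\<^sup>2 \<le> 2" using small nn by linarith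
  then have e2: "2 * \<eta>\<^sup>2 \<le> 1 / w" using w by (simp add: field_simps)
  have "M\<^sup>2 / (4 * w\<^sup>2) \<le> (4 * w / \<alpha>) / (4 * w\<^sup>2)" using M2 by (intro divide_right_mono) auto
  also have "\<dots> = 1 / \<alpha> / w" using w \<alpha> by (simp add: field_simps power2_eq_square)
  finally have Mw: "M\<^sup>2 / (4 * w\<^sup>2) \<le> 1 / \<alpha> / w" .
  have d2: "\<delta>\<^sup>2 \<le> (1 + 1 / \<alpha>) / w"
  proof -
    have "\<delta>\<^sup>2 \<le> (\<eta> + M / (4 * w\<^sup>2))\<^sup>2" using de by (intro power_mono) (auto simp: \<delta>_def)
    also have "\<dots> \<le> 2 * \<eta>\<^sup>2 + 2 * (M / (4 * w\<^sup>2))\<^sup>2"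
      using zero_le_power2[of "\<eta> - M / (4 * w\<^sup>2)"] by (simp add: power2_sum power2_diff)
    also have "2 * (M / (4 * w\<^sup>2))\<^sup>2 = M\<^sup>2 / (4 * w\<^sup>2) * (1 / (2 * w\<^sup>2))"
      using w by (simp add: field_simps power2_eq_square)
    also have "\<dots> \<le> M\<^sup>2 / (4 * w\<^sup>2) * 1"
    proof -
      have "1 \<le> w\<^sup>2" using w by simp
      then have "1 / (2 * w\<^sup>2) \<le> 1" by (subst divide_le_eq_1_pos) linarith+
      then show ?thesis by (intro mult_left_mono) auto
    qed
    finally show ?thesis using Mw e2 by (simp add: add_divide_distrib)
  qed
  have "1 \<le> sqrt 5 * (M * \<delta>) + \<bar>a\<bar> * \<delta>\<^sup>2"
    using disc5_root_badly_approximable[OF root m, of l] unfolding \<delta>_def M_def by simp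
  also have "\<bar>a\<bar> * \<delta>\<^sup>2 \<le> \<bar>a\<bar> * ((1 + 1 / \<alpha>) / w)" using d2 by (intro mult_left_mono) auto
  \<comment> \<open>A factor \<open>sqrt 5\<close> is spent so that all errors share one bracket and
    become \<open>C / w\<close> after division.\<close>
  also have "\<dots> \<le> sqrt 5 * (\<bar>a\<bar> * ((1 + 1 / \<alpha>) / w))"
    using s2 \<alpha> w mult_right_mono[of 1 "sqrt 5" "\<bar>a\<bar> * ((1 + 1 / \<alpha>) / w)"] by simp
  also have "M * \<delta> \<le> M * \<eta> + M\<^sup>2 / (4 * w\<^sup>2)"
    using mult_left_mono[OF de, of M] M by (simp add: power2_eq_square distrib_left)
  also have "M\<^sup>2 / (4 * w\<^sup>2) \<le> 1 / \<alpha> / w" by (rule Mw)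
  finally have "1 \<le> sqrt 5 * (M * \<eta> + 1 / \<alpha> / w + \<bar>a\<bar> * ((1 + 1 / \<alpha>) / w))"
    by (simp add: distrib_left)
  also have "M * \<eta> + 1 / \<alpha> / w + \<bar>a\<bar> * ((1 + 1 / \<alpha>) / w) = M * \<eta> + C / w"
    using w(1) \<alpha>(1) by (simp add: C field_simps)
  finally have Me: "1 / sqrt 5 - C / w \<le> M * \<eta>" by (simp add: field_simps)
  have "4 * sqrt Q * (1 / sqrt 5 - C / w) \<le> 4 * sqrt Q * (M * \<eta>)"
    using Me Q \<alpha> by (intro mult_left_mono) auto
  also have "\<dots> \<le> M\<^sup>2 * Q / w + 4 * w * \<eta>\<^sup>2"
  proof -
    \<comment> \<open>AM-GM for the two summands, multiplied by \<open>w\<close>.\<close>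
    have "0 \<le> (M * sqrt Q - 2 * w * \<eta>)\<^sup>2" by simp
    also have "\<dots> = M\<^sup>2 * Q + 4 * w\<^sup>2 * \<eta>\<^sup>2 - w * (4 * sqrt Q * (M * \<eta>))"
      using Q \<alpha> by (simp add: power2_diff power_mult_distrib)
    finally show ?thesis using w by (simp add: field_simps power2_eq_square)
  qed
  finally show ?thesis unfolding form Q_def w_def by simp
qed simp

text \<open>The bound \<open>h n\<close> is uniform in \<open>m\<close>, so it passes to the
  infimum; both arguments of its minimum tend to the same limit.\<close>

lemma liminf_gamma_ge:
  assumes \<alpha>: "0 < \<alpha>" "\<alpha> < 1" and root: "disc5_root a ((1 - \<alpha>) / 2)"
  shows "ereal (2 * pi\<^sup>2 * sqrt \<alpha> / sqrt 5) \<le> liminf_gamma \<alpha>"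
proof -
  define C where "C = \<bar>a\<bar> * (1 + 1 / \<alpha>) + 1 / \<alpha>"
  define h where "h n = min (4 * sqrt \<alpha> / sqrt 5)
    (4 * sqrt (round (\<alpha> * real n) / n) * (1 / sqrt 5 - C / sqrt n))" for n :: nat
  have "(\<lambda>n. round (\<alpha> * real n) / real n - \<alpha>) \<longlonglongrightarrow> 0"
  proof (rule Lim_null_comparison)
    show "\<forall>\<^sub>F n in sequentially. norm (round (\<alpha> * real n) / real n - \<alpha>) \<le> 1 / (2 * real n)"
      using eventually_gt_at_top[of 0] by eventually_elim (simp only: real_norm_def round_mult_divide_near)
    show "(\<lambda>n. 1 / (2 * real n)) \<longlonglongrightarrow> 0" by real_asymp
  qed
  then have Q: "(\<lambda>n. round (\<alpha> * real n) / real n) \<longlonglongrightarrow> \<alpha>" by (simp add: LIM_zero_iff)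
  have w: "(\<lambda>n. C / sqrt (real n)) \<longlonglongrightarrow> 0" by real_asymp
  have "h \<longlonglongrightarrow> min (4 * sqrt \<alpha> / sqrt 5) (4 * sqrt \<alpha> * (1 / sqrt 5 - 0))"
    unfolding h_def by (intro tendsto_intros Q w)
  then have "(\<lambda>n. pi\<^sup>2 / 2 * h n) \<longlonglongrightarrow> pi\<^sup>2 / 2 * (4 * sqrt \<alpha> / sqrt 5)"
    by (intro tendsto_intros) simp
  then have lim: "(\<lambda>n. ereal (pi\<^sup>2 / 2 * h n)) \<longlonglongrightarrow> ereal (2 * pi\<^sup>2 * sqrt \<alpha> / sqrt 5)"
    by (simp add: mult_ac)
  have "ereal (2 * pi\<^sup>2 * sqrt \<alpha> / sqrt 5) = liminf (\<lambda>n. ereal (pi\<^sup>2 / 2 * h n))"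
    using lim_imp_Liminf[OF _ lim] by simp
  also have "\<dots> \<le> liminf_gamma \<alpha>"
    unfolding liminf_gamma_def
  proof (rule Liminf_mono)
    obtain N :: nat where N: "1 / \<alpha> < N" using reals_Archimedean2 by blast
    show "\<forall>\<^sub>F n in sequentially. ereal (pi\<^sup>2 / 2 * h n)
        \<le> ereal (gamma2 n (round (\<alpha> * real n)) * real n powr (3/2))"
      using eventually_ge_at_top[of N]
    proof eventually_elim
      case (elim n)
      then have n: "real n \<ge> 1 / \<alpha>" using N by simp
      moreover have "0 < 1 / \<alpha>" using \<alpha> by simp
      ultimately have "n > 0" by (cases n) auto
      then show ?case
        unfolding ereal_less_eq h_def using \<alpha> n
        by (intro gamma2_normalized(2) normalized_form_ge[OF \<alpha> root refl _ _ C_def]) auto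
    qed
  qed
  finally show ?thesis .
qed

section \<open>Density of the equality cases\<close>

theorem theorem5:
  shows "(\<forall>\<alpha>\<in>{0<..<1::real}. liminf_gamma \<alpha> \<le> ereal (2 * pi\<^sup>2 * sqrt \<alpha> / sqrt 5)) \<and>
         {0<..<1::real} \<subseteq>
           closure {\<alpha>\<in>{0<..<1}. liminf_gamma \<alpha> = ereal (2 * pi\<^sup>2 * sqrt \<alpha> / sqrt 5)}"
proof (intro conjI ballI subsetI)
  fix \<alpha> :: real assume "\<alpha> \<in> {0<..<1}"
  then show "liminf_gamma \<alpha> \<le> ereal (2 * pi\<^sup>2 * sqrt \<alpha> / sqrt 5)"
    using liminf_gamma_le by simp
next
  fix \<alpha> :: real assume \<alpha>: "\<alpha> \<in> {0<..<1}"
  show "\<alpha> \<in> closure {\<alpha>\<in>{0<..<1}. liminf_gamma \<alpha> = ereal (2 * pi\<^sup>2 * sqrt \<alpha> / sqrt 5)}"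
    unfolding closure_approachable
  proof (intro allI impI)
    fix e :: real assume e: "e > 0"
    \<comment> \<open>The bounds \<alpha> and 1 - \<alpha> keep the nearby point inside (0,1).
      Below, \<open>d / 2\<close> is used because \<open>1 - 2 * x\<close> doubles
      distances.\<close>
    define d where "d = min e (min \<alpha> (1 - \<alpha>))"
    have d: "d > 0" "d \<le> e" "d \<le> \<alpha>" "d \<le> 1 - \<alpha>" using e \<alpha> by (auto simp: d_def)
    obtain a x where x: "disc5_root a x" "\<bar>x - (1 - \<alpha>) / 2\<bar> < d / 2"
      using disc5_root_dense[of "d / 2"] d by auto
    define \<alpha>' where "\<alpha>' = 1 - 2 * x"
    have near: "\<bar>\<alpha>' - \<alpha>\<bar> < d" using x(2) unfolding \<alpha>'_def abs_less_iff by (simp add: field_simps)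
    then have a01: "0 < \<alpha>'" "\<alpha>' < 1" using d by linarith+
    have "disc5_root a ((1 - \<alpha>') / 2)" using x(1) by (simp add: \<alpha>'_def)
    then have "liminf_gamma \<alpha>' = ereal (2 * pi\<^sup>2 * sqrt \<alpha>' / sqrt 5)"
      using a01 by (intro antisym liminf_gamma_le liminf_gamma_ge)
    then show "\<exists>y\<in>{\<alpha>\<in>{0<..<1}. liminf_gamma \<alpha> = ereal (2 * pi\<^sup>2 * sqrt \<alpha> / sqrt 5)}. dist y \<alpha> < e"
      using a01 near d by (intro bexI[of _ \<alpha>']) (auto simp: dist_real_def)
  qed
qed

end
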